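(* Let $n\geq 1$, let $D\in\mathfrak{S}_n$ be a permutation of $[n]=\{1,\dots,n\}$, and let $E\subset[n]$ with $|E|>1$. Suppose that $D$ has either a cycle of length greater than one containing no element of $E$, or a cycle containing at least one element of $E$ and at least one element of $[n]\setminus E$. For a cyclic permutation $\gamma$ of $[n]$ (i.e. an $n$-cycle), let $c_E(D\circ\gamma)$ denote the number of cycles of $D\circ\gamma$ that contain no element of $E$, and let $\theta(D,E)=\max_{\gamma} c_E(D\circ\gamma)$, the maximum over all cyclic permutations $\gamma$ of $[n]$. Then $$\#\{\gamma \text{ cyclic}: c_E(D\circ\gamma)=\theta(D,E)-1\}\;\geq\;\tfrac12\,\#\{\gamma\text{ cyclic}: c_E(D\circ\gamma)=\theta(D,E)\}.$$ Moreover, the constant $1/2$ is best possible: there exist $n$, $D$ and $E$ satisfying the hypotheses for which equality holds.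
   Context: Permutations are composed right to left: $(D\circ\gamma)(x)=D(\gamma(x))$. A cycle of a permutation is said to be $E$-label free if it contains no element of $E$. *)

theory Defs
  imports Complex_Main "HOL-Combinatorics.Combinatorics"
begin

text \<open>Cycles are identified with their supports; fixed points in \<open>[n]\<close> count as cycles of length one.\<close>

definition perm_cycles :: "nat \<Rightarrow> (nat \<Rightarrow> nat) \<Rightarrow> nat set set" where
  "perm_cycles n p = orbit p ` {1..n}"

definition cyclic_perms :: "nat \<Rightarrow> (nat \<Rightarrow> nat) set" where
  "cyclic_perms n = {g. g permutes {1..n} \<and> cyclic_on g {1..n}}"

definition label_free_count :: "nat \<Rightarrow> nat set \<Rightarrow> (nat \<Rightarrow> nat) \<Rightarrow> nat" where
  "label_free_count n E p = card {C \<in> perm_cycles n p. C \<inter> E = {}}"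

definition theta :: "nat \<Rightarrow> (nat \<Rightarrow> nat) \<Rightarrow> nat set \<Rightarrow> nat" where
  "theta n D E = Max ((\<lambda>g. label_free_count n E (D \<circ> g)) ` cyclic_perms n)"

definition admissible :: "nat \<Rightarrow> (nat \<Rightarrow> nat) \<Rightarrow> nat set \<Rightarrow> bool" where
  "admissible n D E \<longleftrightarrow>
     n \<ge> 1 \<and> D permutes {1..n} \<and> E \<subseteq> {1..n} \<and> card E > 1 \<and>
     ((\<exists>C \<in> perm_cycles n D. card C > 1 \<and> C \<inter> E = {}) \<or>
      (\<exists>C \<in> perm_cycles n D. C \<inter> E \<noteq> {} \<and> C \<inter> ({1..n} - E) \<noteq> {}))"

end

theory Submission
  imports Defs
begin

text \<open>
  The count \<open>c\<^sub>E(D \<circ> \<gamma>)\<close> does not change when \<open>D\<close> is replaced by \<open>\<pi> \<circ> D\<close> with \<open>\<pi>\<close> a permutation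
  of \<open>E\<close>, so \<open>D\<close> may be taken with as many cycles as possible in this coset; then every cycle of
  \<open>D\<close> contains at most one element of \<open>E\<close>. Write \<open>\<sigma> = D \<circ> \<gamma>\<close>. The genus inequality
  \<open>c(D) + c(\<sigma>) \<le> n + 1\<close> shows that \<open>\<theta> = n - c(D)\<close>, and that \<open>\<gamma>\<close> is a maximizer iff equality
  holds (that is, the map with vertices the cycles of \<open>D\<close> and \<open>\<sigma>\<close> is a plane tree) and \<open>E\<close> lies in
  one cycle of \<open>\<sigma>\<close>. In the tree case a cycle of \<open>D\<close> and a cycle of \<open>\<sigma>\<close> share at most one point.

  Fix \<open>a \<noteq> b\<close> in \<open>E\<close> and a cycle \<open>C\<close> of \<open>D\<close> of length at least two. For a maximizer pick \<open>y\<close> in \<open>C\<close>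
  outside the \<open>\<sigma>\<close>-cycle containing \<open>E\<close>. Replacing \<open>\<sigma>\<close> by \<open>(b y)(a b)\<sigma>\<close> cuts this cycle between
  \<open>a\<close> and \<open>b\<close> and glues the part of \<open>b\<close> to the cycle of \<open>y\<close>, which costs exactly one \<open>E\<close>-free cycle;
  either this move or the one with \<open>a\<close> and \<open>b\<close> exchanged keeps \<open>\<gamma>\<close> cyclic. Each of the two moves
  is injective, because \<open>y\<close> is recovered as the only common point of \<open>C\<close> and the new cycle through \<open>b\<close>
  (respectively \<open>a\<close>). Hence the maximizers are at most twice as many as the next level.
\<close>

subsection \<open>Orbits and multiplication by a transposition\<close>

lemma orbit_subset_closed:
  assumes "a \<in> A" "\<And>z. z \<in> A \<Longrightarrow> f z \<in> A"
  shows "orbit f a \<subseteq> A"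
proof
  fix y assume "y \<in> orbit f a"
  then show "y \<in> A" by induct (auto simp: assms)
qed

lemma orbit_eq_iff:
  assumes "permutation p"
  shows "orbit p a = orbit p b \<longleftrightarrow> a \<in> orbit p b"
  using cyclic_on_orbit'[OF assms] permutation_self_in_orbit[OF assms]
  by (metis orbit_cyclic_eq3)

lemma orbit_apply_iff:
  assumes "permutation p"
  shows "p z \<in> orbit p a \<longleftrightarrow> z \<in> orbit p a"
  by (metis assms orbit_eq_iff permutation_orbit_step)

lemma orbit_sym:
  assumes "permutation p"
  shows "a \<in> orbit p b \<longleftrightarrow> b \<in> orbit p a"
  using orbit_eq_iff[OF assms] by metis

lemma permutation_transpose_comp [simp]:
  "permutation (transpose a b \<circ> p) \<longleftrightarrow> permutation p"
proof
  assume "permutation (transpose a b \<circ> p)"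
  then have "permutation (transpose a b \<circ> (transpose a b \<circ> p))"
    by (rule permutation_compose[OF permutation_swap_id])
  then show "permutation p" by (simp add: comp_assoc[symmetric])
qed (intro permutation_compose permutation_swap_id)

lemma orbit_transpose_comp_other:
  assumes "permutation p" "a \<notin> orbit p z" "b \<notin> orbit p z"
  shows "orbit (transpose a b \<circ> p) z = orbit p z"
proof (rule orbit_cong)
  show "z \<in> orbit p z" using assms(1) by (rule permutation_self_in_orbit)
  fix s assume "s \<in> orbit p z"
  then have "p s \<in> orbit p z" by (rule orbit.step)
  then show "(transpose a b \<circ> p) s = p s" using assms(2,3) by (auto simp: transpose_def)
qed

text \<open>Before the first return of \<open>p\<close> to \<open>a\<close> neither \<open>a\<close>
  nor \<open>b\<close> is met, so both permutations move alike; at the return the swap diverts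
  \<open>a\<close> to \<open>b\<close>.\<close>

lemma transpose_comp_joins:
  assumes p: "permutation p" and ab: "b \<notin> orbit p a"
  shows "b \<in> orbit (transpose a b \<circ> p) a"
proof -
  let ?q = "transpose a b \<circ> p"
  let ?N = "funpow_dist1 p a a"
  have a: "a \<in> orbit p a" using p by (rule permutation_self_in_orbit)
  have *: "(?q ^^ i) a = (p ^^ i) a" if "i < ?N" for i
    using that
  proof (induction i)
    case (Suc i)
    have "(p ^^ Suc i) a \<noteq> a" using funpow_dist1_least[of "Suc i" p a a] Suc.prems by simp
    moreover have "(p ^^ Suc i) a \<noteq> b" using ab funpow_in_orbit[OF a] by metis
    ultimately show ?case using Suc by simp
  qed simp
  have "(?q ^^ ?N) a = ?q ((p ^^ (?N - 1)) a)" using *[of "?N - 1"] by simp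
  also have "\<dots> = transpose a b ((p ^^ ?N) a)" by simp
  also have "\<dots> = b" using funpow_dist1_prop[OF a] by simp
  finally have "b = (?q ^^ ?N) a \<and> 0 < ?N" by (simp del: funpow.simps)
  then show ?thesis unfolding orbit_altdef by blast
qed

text \<open>The new permutation follows \<open>p\<close> from \<open>a\<close> and, where
  \<open>p\<close> would enter \<open>b\<close>, jumps back to \<open>a\<close>; its cycle through
  \<open>a\<close> is the segment before \<open>b\<close>.\<close>

lemma transpose_comp_separates:
  assumes p: "permutation p" and ab: "b \<in> orbit p a" "a \<noteq> b"
  shows "b \<notin> orbit (transpose a b \<circ> p) a"
proof -
  let ?q = "transpose a b \<circ> p"
  let ?N = "funpow_dist p a b"
  have N0: "?N > 0" using ab funpow_dist_0_eq[OF ab(1)] by simp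
  have *: "(?q ^^ i) a = (p ^^ i) a" if "i < ?N" for i
    using that
  proof (induction i)
    case (Suc i)
    have "(p ^^ Suc i) a \<noteq> (p ^^ 0) a"
      using Suc.prems by (intro funpow_neq_less_funpow_dist[OF ab(1)]) auto
    moreover have "(p ^^ Suc i) a \<noteq> b" using funpow_dist_least[OF Suc.prems] .
    ultimately show ?case using Suc by simp
  qed simp
  have "(?q ^^ ?N) a = ?q ((?q ^^ (?N - 1)) a)"
    using N0 by (metis One_nat_def Suc_pred comp_apply funpow.simps(2))
  also have "\<dots> = ?q ((p ^^ (?N - 1)) a)" using *[of "?N - 1"] N0 by simp
  also have "\<dots> = transpose a b ((p ^^ ?N) a)"
    using N0 by (metis One_nat_def Suc_pred comp_apply funpow.simps(2))
  also have "\<dots> = a" using funpow_dist_prop[OF ab(1)] by simp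
  finally have "orbit ?q a = {(?q ^^ m) a |m. m < ?N}"
    using N0 by (rule orbit_altdef_bounded)
  also have "\<dots> = {(p ^^ m) a |m. m < ?N}" using * by (auto simp del: funpow.simps) metis
  finally show ?thesis using funpow_dist_least[of _ p a b] by auto
qed

lemma orbit_transpose_comp_merge:
  assumes p: "permutation p" and ab: "b \<notin> orbit p a"
  shows "orbit (transpose a b \<circ> p) a = orbit p a \<union> orbit p b"
    and "orbit (transpose a b \<circ> p) b = orbit p a \<union> orbit p b"
proof -
  let ?q = "transpose a b \<circ> p"
  note self = permutation_self_in_orbit[OF p]
  have q: "permutation ?q" using p by simp
  have aq: "a \<in> orbit ?q a" using q by (rule permutation_self_in_orbit)
  have bq: "b \<in> orbit ?q a" using transpose_comp_joins[OF assms] .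
  have 1: "orbit ?q a \<subseteq> orbit p a \<union> orbit p b"
  proof (rule orbit_subset_closed)
    fix z assume "z \<in> orbit p a \<union> orbit p b"
    then have "p z \<in> orbit p a \<union> orbit p b" by (auto intro: orbit.step)
    then show "?q z \<in> orbit p a \<union> orbit p b" using self by (auto simp: transpose_def)
  qed (use self in auto)
  have cl: "p z \<in> orbit ?q a" if "z \<in> orbit ?q a" for z
  proof -
    have "?q z \<in> orbit ?q a" using that by (rule orbit.step)
    then show ?thesis using aq bq by (cases "p z = a \<or> p z = b") auto
  qed
  have 2: "orbit p a \<subseteq> orbit ?q a" "orbit p b \<subseteq> orbit ?q a"
    using orbit_subset_closed aq bq cl by metis+
  show A: "orbit ?q a = orbit p a \<union> orbit p b" using 1 2 by blast
  show "orbit ?q b = orbit p a \<union> orbit p b" using A bq orbit_eq_iff[OF q] by metis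
qed

text \<open>The merge case read backwards, since a transposition is an involution.\<close>

lemma orbit_transpose_comp_split:
  assumes p: "permutation p" and ab: "b \<in> orbit p a" "a \<noteq> b"
  shows "orbit p a = orbit (transpose a b \<circ> p) a \<union> orbit (transpose a b \<circ> p) b"
proof -
  let ?q = "transpose a b \<circ> p"
  have "orbit (transpose a b \<circ> ?q) a = orbit ?q a \<union> orbit ?q b"
    using p transpose_comp_separates[OF assms] by (intro orbit_transpose_comp_merge) auto
  then show ?thesis by (simp add: comp_assoc[symmetric])
qed

section \<open>Cycle counts and cyclic permutations\<close>

lemma permutes_imp_permutation_atLeastAtMost:
  "p permutes {1..n::nat} \<Longrightarrow> permutation p"
  using permutation_permutes by blast

lemma finite_perm_cycles [simp]: "finite (perm_cycles n p)"
  by (simp add: perm_cycles_def)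

lemma card_perm_cycles_merge:
  assumes p: "p permutes {1..n}" and ab: "a \<in> {1..n}" "b \<in> {1..n}" "b \<notin> orbit p a"
  shows "card (perm_cycles n p) = card (perm_cycles n (transpose a b \<circ> p)) + 1"
proof -
  let ?q = "transpose a b \<circ> p"
  have P: "permutation p" using p by (rule permutes_imp_permutation_atLeastAtMost)
  then have Q: "permutation ?q" by simp
  note M = orbit_transpose_comp_merge[OF P ab(3)]
  \<comment> \<open>The cycles avoiding both \<open>a\<close> and \<open>b\<close> are common to the
    two permutations, so only the cycles through \<open>a\<close> and \<open>b\<close> need
    comparing.\<close>
  define R where "R = orbit p ` {z \<in> {1..n}. a \<notin> orbit p z \<and> b \<notin> orbit p z}"
  have fin: "finite R" by (simp add: R_def)
  have cp: "perm_cycles n p = insert (orbit p a) (insert (orbit p b) R)"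
  proof
    show "perm_cycles n p \<subseteq> insert (orbit p a) (insert (orbit p b) R)"
      unfolding perm_cycles_def R_def using orbit_eq_iff[OF P, of a] orbit_eq_iff[OF P, of b] by blast
    show "insert (orbit p a) (insert (orbit p b) R) \<subseteq> perm_cycles n p"
      unfolding perm_cycles_def R_def using ab by blast
  qed
  have R': "R = orbit ?q ` {z \<in> {1..n}. a \<notin> orbit p z \<and> b \<notin> orbit p z}"
    unfolding R_def using orbit_transpose_comp_other[OF P] by (intro image_cong) auto
  have cq: "perm_cycles n ?q = insert (orbit ?q a) R"
  proof
    show "perm_cycles n ?q \<subseteq> insert (orbit ?q a) R"
    proof
      fix C assume "C \<in> perm_cycles n ?q"
      then obtain z where z: "z \<in> {1..n}" "C = orbit ?q z" by (auto simp: perm_cycles_def)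
      show "C \<in> insert (orbit ?q a) R"
      proof (cases "a \<notin> orbit p z \<and> b \<notin> orbit p z")
        case True then show ?thesis using z R' by blast
      next
        case False
        then have "z \<in> orbit ?q a" using M orbit_sym[OF P] by blast
        then show ?thesis using z orbit_eq_iff[OF Q] by blast
      qed
    qed
    show "insert (orbit ?q a) R \<subseteq> perm_cycles n ?q"
      using ab R' by (auto simp: perm_cycles_def)
  qed
  have self: "a \<in> orbit p a" "b \<in> orbit p b" "a \<in> orbit ?q a"
    using permutation_self_in_orbit[OF P] permutation_self_in_orbit[OF Q] by auto
  then have "orbit p a \<notin> R" "orbit p b \<notin> R" "orbit ?q a \<notin> R" "orbit p a \<noteq> orbit p b"
    using ab(3) by (auto simp: R_def)
  then show ?thesis using fin by (simp add: cp cq)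
qed

lemma transpose_comp_permutes:
  "p permutes S \<Longrightarrow> a \<in> S \<Longrightarrow> b \<in> S \<Longrightarrow> transpose a b \<circ> p permutes S"
  by (intro permutes_compose permutes_swap_id)

lemma card_perm_cycles_split:
  assumes p: "p permutes {1..n}" and ab: "a \<in> {1..n}" "b \<in> {1..n}" "b \<in> orbit p a" "a \<noteq> b"
  shows "card (perm_cycles n (transpose a b \<circ> p)) = card (perm_cycles n p) + 1"
proof -
  have P: "permutation p" using p by (rule permutes_imp_permutation_atLeastAtMost)
  have "card (perm_cycles n (transpose a b \<circ> p))
      = card (perm_cycles n (transpose a b \<circ> (transpose a b \<circ> p))) + 1"
    using transpose_comp_permutes[OF p ab(1,2)] ab transpose_comp_separates[OF P ab(3,4)]
    by (intro card_perm_cycles_merge) auto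
  then show ?thesis by (simp add: comp_assoc[symmetric])
qed

text \<open>With cyclicity expressed as a cycle count, splitting and merging decide whether an
  altered permutation is still an \<open>n\<close>-cycle.\<close>

lemma cyclic_perms_iff_card:
  assumes "n \<ge> 1"
  shows "g \<in> cyclic_perms n \<longleftrightarrow> g permutes {1..n} \<and> card (perm_cycles n g) = 1"
proof (cases "g permutes {1..n}")
  case True
  then have P: "permutation g" by (rule permutes_imp_permutation_atLeastAtMost)
  have "cyclic_on g {1..n} \<longleftrightarrow> card (perm_cycles n g) = 1"
  proof
    assume "cyclic_on g {1..n}"
    then have "perm_cycles n g = {{1..n}}"
      using assms by (auto simp: perm_cycles_def cyclic_on_alldef)
    then show "card (perm_cycles n g) = 1" by simp
  next
    assume "card (perm_cycles n g) = 1"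
    then obtain C where C: "orbit g ` {1..n} = {C}"
      by (auto simp: perm_cycles_def card_1_singleton_iff)
    have C1: "orbit g 1 = C" using C assms by auto
    have "{1..n} \<subseteq> C" using permutation_self_in_orbit[OF P] C by blast
    moreover have "C \<subseteq> {1..n}" using permutes_orbit_subset[OF True, of 1] C1 assms by auto
    ultimately have "{1..n} = orbit g 1" using C1 by blast
    moreover have "1 \<in> {1..n}" using assms by simp
    ultimately show "cyclic_on g {1..n}" by (rule cyclic_on_singleI[rotated])
  qed
  then show ?thesis using True by (simp add: cyclic_perms_def)
qed (simp add: cyclic_perms_def)

text \<open>A permutation with the fewest cycles is cyclic, because two different cycles could be
  merged by a transposition.\<close>

lemma cyclic_perms_nonempty:
  assumes "n \<ge> 1"
  shows "cyclic_perms n \<noteq> {}"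
proof -
  let ?m = "\<lambda>p. card (perm_cycles n p)"
  have "\<exists>g. g permutes {1..n} \<and> (\<forall>p. p permutes {1..n} \<longrightarrow> ?m g \<le> ?m p)"
    by (rule ex_has_least_nat[where k = id]) (rule permutes_id)
  then obtain g where g: "g permutes {1..n}"
    and min: "\<And>p. p permutes {1..n} \<Longrightarrow> ?m g \<le> ?m p" by blast
  have "orbit g z = orbit g 1" if "z \<in> {1..n}" for z
  proof (rule ccontr)
    assume "orbit g z \<noteq> orbit g 1"
    then have "z \<notin> orbit g 1"
      using orbit_eq_iff[OF permutes_imp_permutation_atLeastAtMost[OF g]] by blast
    then have "card (perm_cycles n g) = card (perm_cycles n (transpose 1 z \<circ> g)) + 1"
      using assms that g by (intro card_perm_cycles_merge) auto
    then show False
      using min[OF transpose_comp_permutes[OF g, of 1 z]] assms that by simp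
  qed
  moreover have "1 \<in> {1..n}" using assms by simp
  ultimately have "perm_cycles n g = {orbit g 1}" unfolding perm_cycles_def by blast
  then show ?thesis using g cyclic_perms_iff_card[OF assms, of g] by auto
qed

lemma card_perm_cycles_le: "card (perm_cycles n p) \<le> n"
  using card_image_le[of "{1..n}" "orbit p"] by (simp add: perm_cycles_def)

lemma card_perm_cycles_id: "card (perm_cycles n id) = n"
proof -
  have "orbit id x = {x}" for x :: nat by (simp add: orbit_eq_singleton_iff)
  then have "inj_on (orbit id) {1..n}" by (auto intro: inj_onI)
  then show ?thesis by (simp add: perm_cycles_def card_image)
qed

lemma permutes_neq_id_moves:
  assumes "p permutes S" "p \<noteq> id"
  obtains x where "x \<in> S" "p x \<in> S" "p x \<noteq> x"
proof -
  from assms(2) obtain x where "p x \<noteq> x" by (auto simp: fun_eq_iff)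
  moreover from this have "x \<in> S" using assms(1) by (auto simp: permutes_def)
  ultimately show thesis using that permutes_in_image[OF assms(1)] by blast
qed

subsection \<open>The genus inequality\<close>

text \<open>The Riemann--Hurwitz genus inequality for one-face maps: each transposition changes both
  counts by exactly one.\<close>

lemma card_perm_cycles_comp_cyclic_le:
  assumes "n \<ge> 1" "D permutes {1..n}" and g: "g \<in> cyclic_perms n"
  shows "card (perm_cycles n D) + card (perm_cycles n (D \<circ> g)) \<le> n + 1"
  using assms(2)
proof (induction "n - card (perm_cycles n D)" arbitrary: D rule: less_induct)
  case less
  have gp: "g permutes {1..n}" and g1: "card (perm_cycles n g) = 1"
    using g cyclic_perms_iff_card[OF assms(1)] by auto
  show ?case
  proof (cases "D = id")
    case True
    then show ?thesis using g1 by (simp add: card_perm_cycles_id)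
  next
    case False
    then obtain x where x: "x \<in> {1..n}" "D x \<in> {1..n}" "D x \<noteq> x"
      using permutes_neq_id_moves[OF less.prems] by blast
    let ?t = "transpose x (D x)"
    have s: "D \<circ> g permutes {1..n}" using gp less.prems by (intro permutes_compose)
    have Dt: "card (perm_cycles n (?t \<circ> D)) = card (perm_cycles n D) + 1"
      using x less.prems by (intro card_perm_cycles_split) (auto intro: orbit.base)
    \<comment> \<open>It is not known whether a cycle of \<open>D \<circ> g\<close> splits or
      merges. Either way the count drops by at most one, and the extra cycle recorded in
      \<open>Dt\<close> pays for it.\<close>
    have st: "card (perm_cycles n (D \<circ> g)) \<le> card (perm_cycles n (?t \<circ> (D \<circ> g))) + 1"
      using card_perm_cycles_split[OF s x(1,2)] card_perm_cycles_merge[OF s x(1,2)] x(3)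
      by fastforce
    have "card (perm_cycles n (?t \<circ> D)) + card (perm_cycles n ((?t \<circ> D) \<circ> g)) \<le> n + 1"
      using Dt card_perm_cycles_le[of n "?t \<circ> D"] x less.prems
      by (intro less.hyps transpose_comp_permutes) auto
    then show ?thesis using Dt st by (simp add: comp_assoc)
  qed
qed

text \<open>Two distinct common points would let one transposition split a cycle of \<open>D\<close>
  and a cycle of \<open>D \<circ> g\<close> at once, exceeding the genus bound for the same
  \<open>g\<close>.\<close>

lemma genus_zero_orbits_meet_once:
  assumes "n \<ge> 1" and D: "D permutes {1..n}" and g: "g \<in> cyclic_perms n"
    and eq: "card (perm_cycles n D) + card (perm_cycles n (D \<circ> g)) = n + 1"
    and x: "x \<in> {1..n}" and xy: "y \<in> orbit D x" "y \<in> orbit (D \<circ> g) x"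
  shows "x = y"
proof (rule ccontr)
  assume ne: "x \<noteq> y"
  have gp: "g permutes {1..n}" using g by (simp add: cyclic_perms_def)
  have y: "y \<in> {1..n}" using permutes_orbit_subset[OF D x] xy by blast
  let ?t = "transpose x y"
  have s: "D \<circ> g permutes {1..n}" using gp D by (intro permutes_compose)
  have "card (perm_cycles n (?t \<circ> D)) = card (perm_cycles n D) + 1"
    using x y ne xy D by (intro card_perm_cycles_split)
  moreover have "card (perm_cycles n (?t \<circ> (D \<circ> g))) = card (perm_cycles n (D \<circ> g)) + 1"
    using x y ne xy s by (intro card_perm_cycles_split)
  moreover have "card (perm_cycles n (?t \<circ> D)) + card (perm_cycles n ((?t \<circ> D) \<circ> g)) \<le> n + 1"
    using assms(1) g transpose_comp_permutes[OF D x y] by (intro card_perm_cycles_comp_cyclic_le)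
  ultimately show False using eq by (simp add: comp_assoc)
qed

text \<open>Turns a change of \<open>g\<close> by a transposition into a change of
  \<open>D \<circ> g\<close> by a transposition.\<close>

lemma comp_transpose_inj:
  assumes "inj f"
  shows "f \<circ> transpose a b = transpose (f a) (f b) \<circ> f"
  using inj_eq[OF assms] by (auto simp: fun_eq_iff transpose_def)

lemma transpose_comp_left_cancel:
  "transpose a b \<circ> f = transpose a b \<circ> g \<longleftrightarrow> f = g"
  by (auto simp: fun_eq_iff dest: transpose_eq_imp_eq)

subsection \<open>The maximal number of label free cycles\<close>

text \<open>The cycle of \<open>e\<close> contains a label, so at least one cycle is not counted; it
  is the only uncounted one exactly when it contains all labels.\<close>

lemma label_free_count_less:
  assumes s: "s permutes {1..n}" and e: "e \<in> E" "E \<subseteq> {1..n}"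
  shows "label_free_count n E s + 1 \<le> card (perm_cycles n s)"
    and "label_free_count n E s + 1 = card (perm_cycles n s) \<longleftrightarrow> E \<subseteq> orbit s e"
proof -
  let ?F = "{C \<in> perm_cycles n s. C \<inter> E = {}}"
  have P: "permutation s" using s by (rule permutes_imp_permutation_atLeastAtMost)
  note self = permutation_self_in_orbit[OF P]
  have in_cycles: "orbit s u \<in> perm_cycles n s" if "u \<in> E" for u
    using that e by (auto simp: perm_cycles_def)
  have notin: "orbit s u \<notin> ?F" if "u \<in> E" for u using self that by blast
  have finF: "finite ?F" by simp
  have sub: "insert (orbit s e) ?F \<subseteq> perm_cycles n s" using in_cycles e by blast
  have card_ins: "card (insert (orbit s e) ?F) = label_free_count n E s + 1"
    using notin[OF e(1)] finF by (simp add: label_free_count_def)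
  show "label_free_count n E s + 1 \<le> card (perm_cycles n s)"
    using card_mono[OF finite_perm_cycles sub] card_ins by simp
  show "label_free_count n E s + 1 = card (perm_cycles n s) \<longleftrightarrow> E \<subseteq> orbit s e"
  proof
    assume "label_free_count n E s + 1 = card (perm_cycles n s)"
    then have eq: "insert (orbit s e) ?F = perm_cycles n s"
      using card_subset_eq[OF finite_perm_cycles sub] card_ins by simp
    show "E \<subseteq> orbit s e"
    proof
      fix u assume u: "u \<in> E"
      then have "orbit s u \<in> insert (orbit s e) ?F" using eq in_cycles by simp
      then have "orbit s u = orbit s e" using notin[OF u] by blast
      then show "u \<in> orbit s e" using self by blast
    qed
  next
    assume E: "E \<subseteq> orbit s e"
    have "perm_cycles n s \<subseteq> insert (orbit s e) ?F"
    proof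
      fix C assume C: "C \<in> perm_cycles n s"
      then obtain z where z: "C = orbit s z" by (auto simp: perm_cycles_def)
      show "C \<in> insert (orbit s e) ?F"
      proof (cases "C \<inter> E = {}")
        case False
        then obtain u where "u \<in> orbit s z" "u \<in> orbit s e" using z E by blast
        then have "orbit s u = orbit s z" "orbit s u = orbit s e"
          using orbit_eq_iff[OF P] by auto
        then show ?thesis using z by simp
      qed (use C in simp)
    qed
    then have "insert (orbit s e) ?F = perm_cycles n s" using sub by blast
    then show "label_free_count n E s + 1 = card (perm_cycles n s)" using card_ins by simp
  qed
qed

text \<open>Induction on \<open>D\<close>: detach a point \<open>x \<notin> E\<close> from its cycle, take a solution for the smaller
  permutation, and move \<open>x\<close> in \<open>\<gamma>\<close> to just before \<open>D\<^sup>-\<^sup>1 x\<close>, so that \<open>x\<close> becomes a fixed point of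
  \<open>D \<circ> \<gamma>\<close>.\<close>

lemma exists_genus_zero:
  assumes n: "n \<ge> 1" and "D permutes {1..n}"
    and "\<And>a b. a \<in> E \<Longrightarrow> b \<in> E \<Longrightarrow> b \<in> orbit D a \<Longrightarrow> a = b"
    and e: "e \<in> E" "E \<subseteq> {1..n}"
  shows "\<exists>g \<in> cyclic_perms n. card (perm_cycles n D) + card (perm_cycles n (D \<circ> g)) = n + 1
      \<and> E \<subseteq> orbit (D \<circ> g) e"
  using assms(2,3)
proof (induction "n - card (perm_cycles n D)" arbitrary: D rule: less_induct)
  case less
  note D = less.prems(1)
  note sep = less.prems(2)
  have PD: "permutation D" using D by (rule permutes_imp_permutation_atLeastAtMost)
  show ?case
  proof (cases "D = id")
    case True
    \<comment> \<open>The identity has \<open>n\<close> cycles and \<open>g\<close> has one, so any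
      cyclic \<open>g\<close> attains equality, and its single cycle contains
      \<open>E\<close>.\<close>
    obtain g where g: "g \<in> cyclic_perms n" using cyclic_perms_nonempty[OF n] by blast
    then have "cyclic_on g {1..n}" "card (perm_cycles n g) = 1"
      using cyclic_perms_iff_card[OF n] by (auto simp: cyclic_perms_def)
    moreover have "orbit g e = {1..n}" using calculation e by (auto simp: cyclic_on_alldef)
    ultimately show ?thesis using True g e by (auto simp: card_perm_cycles_id)
  next
    case False
    then obtain z where z: "z \<in> {1..n}" "D z \<in> {1..n}" "D z \<noteq> z"
      using permutes_neq_id_moves[OF D] by blast
    \<comment> \<open>By \<open>sep\<close>, two consecutive distinct points of a cycle of
      \<open>D\<close> cannot both lie in \<open>E\<close>, so \<open>z\<close> or
      \<open>D z\<close> serves.\<close>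
    obtain x where x: "x \<in> {1..n}" "D x \<in> {1..n}" "D x \<noteq> x" "x \<notin> E"
    proof (cases "z \<in> E")
      case True
      have "D z \<notin> E" using sep[OF True, of "D z"] z(3) by (auto intro: orbit.base)
      moreover have "D (D z) \<noteq> D z" using inj_eq[OF permutes_inj[OF D]] z(3) by simp
      moreover have "D (D z) \<in> {1..n}" using z(2) permutes_in_image[OF D] by blast
      ultimately show ?thesis using that z by blast
    qed (use z that in blast)
    define D' where "D' = transpose x (D x) \<circ> D"
    have D': "D' permutes {1..n}"
      unfolding D'_def using D x by (intro transpose_comp_permutes) auto
    have D'x: "D' x = x" by (simp add: D'_def)
    have cD': "card (perm_cycles n D') = card (perm_cycles n D) + 1"
      unfolding D'_def using x D by (intro card_perm_cycles_split) (auto intro: orbit.base)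
    have orbD': "orbit D' a \<subseteq> orbit D a" for a
    proof (rule orbit_subset_closed)
      show "a \<in> orbit D a" using PD by (rule permutation_self_in_orbit)
      fix u assume "u \<in> orbit D a"
      then have Du: "D u \<in> orbit D a" by (rule orbit.step)
      then show "D' u \<in> orbit D a"
        using orbit_apply_iff[OF PD, of x a] by (auto simp: D'_def transpose_def)
    qed
    have "\<exists>g \<in> cyclic_perms n. card (perm_cycles n D') + card (perm_cycles n (D' \<circ> g)) = n + 1
      \<and> E \<subseteq> orbit (D' \<circ> g) e"
    proof (rule less.hyps)
      show "n - card (perm_cycles n D') < n - card (perm_cycles n D)"
        using cD' card_perm_cycles_le[of n D'] by simp
      show "a = b" if "a \<in> E" "b \<in> E" "b \<in> orbit D' a" for a b
        using that orbD' sep by blast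
    qed (rule D')
    then obtain g where g: "g \<in> cyclic_perms n"
      and card_g: "card (perm_cycles n D') + card (perm_cycles n (D' \<circ> g)) = n + 1"
      and E_g: "E \<subseteq> orbit (D' \<circ> g) e" by blast
    have gp: "g permutes {1..n}" and g1: "card (perm_cycles n g) = 1" and gc: "cyclic_on g {1..n}"
      using g cyclic_perms_iff_card[OF n] by (auto simp: cyclic_perms_def)
    have gx: "g x \<noteq> x"
    proof
      assume "g x = x"
      then have "orbit g x = {x}" by (simp add: orbit_eq_singleton_iff)
      then have "{1..n} = {x}" using gc x(1) by (auto simp: cyclic_on_alldef)
      then show False using x by simp
    qed
    have gxn: "g x \<in> {1..n}" using x(1) permutes_in_image[OF gp] by blast
    define s' where "s' = D' \<circ> g"
    define s where "s = transpose x (s' x) \<circ> s'"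
    define f where "f = inv D x"
    \<comment> \<open>\<open>h\<close> drops \<open>x\<close> from the cycle of \<open>g\<close>,
      and \<open>k\<close> puts it back immediately before \<open>f\<close>, so that
      \<open>k x = f\<close> and \<open>D (k x) = x\<close>.\<close>
    define h where "h = transpose x (g x) \<circ> g"
    define k where "k = transpose x f \<circ> h"
    have Df: "D f = x" unfolding f_def using permutes_surj[OF D] by (simp add: surj_f_inv_f)
    have fx: "f \<noteq> x" using Df x(3) by auto
    have fn: "f \<in> {1..n}" using Df x(1) permutes_in_image[OF D] by metis
    have s': "s' permutes {1..n}" unfolding s'_def using D' gp by (intro permutes_compose)
    then have Ps': "permutation s'" by (rule permutes_imp_permutation_atLeastAtMost)
    have s'n: "s' x \<in> {1..n}" using x(1) permutes_in_image[OF s'] by blast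
    have s'x: "s' x \<noteq> x"
      using inj_eq[OF permutes_inj[OF D'], of "g x" x] D'x gx by (simp add: s'_def)
    have Ps: "permutation s" using Ps' by (simp add: s_def)
    \<comment> \<open>Moved across \<open>D\<close>, the transposition in \<open>k\<close> turns
      \<open>D\<close> into \<open>D'\<close>; moved across \<open>D'\<close>, the one in
      \<open>h\<close> cuts \<open>x\<close> out of its cycle in \<open>s'\<close>.\<close>
    have Dk: "D \<circ> k = s"
    proof -
      have "D \<circ> k = (D \<circ> transpose x f) \<circ> h" by (simp add: k_def comp_assoc)
      also have "\<dots> = D' \<circ> h"
        by (simp add: comp_transpose_inj[OF permutes_inj[OF D]] Df D'_def transpose_commute)
      also have "\<dots> = (D' \<circ> transpose x (g x)) \<circ> g" by (simp add: h_def comp_assoc)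
      also have "\<dots> = s"
        by (simp add: comp_transpose_inj[OF permutes_inj[OF D']] D'x s_def s'_def comp_assoc)
      finally show ?thesis .
    qed
    have hp: "h permutes {1..n}"
      unfolding h_def using gp x gxn by (intro transpose_comp_permutes)
    have kp: "k permutes {1..n}"
      unfolding k_def using hp x fn by (intro transpose_comp_permutes)
    have ch: "card (perm_cycles n h) = 2"
      using card_perm_cycles_split[OF gp x(1) gxn orbit.base] gx g1 by (simp add: h_def)
    have "h x = x" by (simp add: h_def)
    then have "f \<notin> orbit h x" using fx by (simp add: orbit_eq_singleton_iff[THEN iffD2])
    then have "card (perm_cycles n k) = 1"
      using card_perm_cycles_merge[OF hp x(1) fn] ch by (simp add: k_def)
    then have kc: "k \<in> cyclic_perms n" using kp cyclic_perms_iff_card[OF n] by blast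
    have cs: "card (perm_cycles n s) = card (perm_cycles n s') + 1"
      unfolding s_def using s' x(1) s'n orbit.base s'x[symmetric] by (rule card_perm_cycles_split)
    have "s x = x" by (simp add: s_def)
    then have sx: "orbit s x = {x}" by (simp add: orbit_eq_singleton_iff)
    \<comment> \<open>Removing the unlabelled point \<open>x\<close> from the cycle of
      \<open>e\<close> keeps all labels together; if \<open>x\<close> lies elsewhere, that cycle is
      untouched.\<close>
    have "E \<subseteq> orbit s e"
    proof (cases "x \<in> orbit s' e")
      case True
      then have "orbit s' e = orbit s' x" using orbit_eq_iff[OF Ps'] by metis
      also have "\<dots> = {x} \<union> orbit s (s' x)"
        using orbit_transpose_comp_split[OF Ps' orbit.base s'x[symmetric]] sx by (simp add: s_def)
      finally have "E \<subseteq> orbit s (s' x)" using E_g x(4) by (auto simp: s'_def)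
      moreover have "orbit s e = orbit s (s' x)"
        using calculation e orbit_eq_iff[OF Ps] by blast
      ultimately show ?thesis by simp
    next
      case False
      then have "orbit s e = orbit s' e" unfolding s_def
        using Ps' orbit_apply_iff[OF Ps'] by (intro orbit_transpose_comp_other) auto
      then show ?thesis using E_g by (simp add: s'_def)
    qed
    \<comment> \<open>\<open>s\<close> has one cycle more than \<open>s'\<close>, and
      \<open>D\<close> one fewer than \<open>D'\<close>, so the sum is preserved.\<close>
    moreover have "card (perm_cycles n D) + card (perm_cycles n s) = n + 1"
      using cs cD' card_g by (simp add: s'_def)
    ultimately show ?thesis using kc Dk by blast
  qed
qed

lemma finite_cyclic_perms [simp]: "finite (cyclic_perms n)"
  by (rule finite_subset[OF _ finite_permutations[of "{1..n}"]]) (auto simp: cyclic_perms_def)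

text \<open>Adds the genus inequality and the loss of the cycle of \<open>e\<close>; equality in the
  sum forces equality in both.\<close>

lemma label_free_count_le:
  assumes n: "n \<ge> 1" and D: "D permutes {1..n}" and g: "g \<in> cyclic_perms n"
    and e: "e \<in> E" "E \<subseteq> {1..n}"
  shows "label_free_count n E (D \<circ> g) + card (perm_cycles n D) \<le> n"
    and "label_free_count n E (D \<circ> g) + card (perm_cycles n D) = n \<longleftrightarrow>
      card (perm_cycles n D) + card (perm_cycles n (D \<circ> g)) = n + 1 \<and> E \<subseteq> orbit (D \<circ> g) e"
proof -
  have s: "D \<circ> g permutes {1..n}" using D g by (auto simp: cyclic_perms_def intro: permutes_compose)
  note * = label_free_count_less[OF s e] card_perm_cycles_comp_cyclic_le[OF n D g]
  show "label_free_count n E (D \<circ> g) + card (perm_cycles n D) \<le> n" using *(1,3) by linarith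
  show "label_free_count n E (D \<circ> g) + card (perm_cycles n D) = n \<longleftrightarrow>
      card (perm_cycles n D) + card (perm_cycles n (D \<circ> g)) = n + 1 \<and> E \<subseteq> orbit (D \<circ> g) e"
    using * by linarith
qed

text \<open>The separation hypothesis supplies a cyclic permutation attaining the upper bound of
  \<open>label_free_count_le\<close>.\<close>

lemma theta_eq:
  assumes n: "n \<ge> 1" and D: "D permutes {1..n}"
    and sep: "\<And>a b. a \<in> E \<Longrightarrow> b \<in> E \<Longrightarrow> b \<in> orbit D a \<Longrightarrow> a = b"
    and e: "e \<in> E" "E \<subseteq> {1..n}"
  shows "theta n D E + card (perm_cycles n D) = n"
proof -
  obtain g where g: "g \<in> cyclic_perms n"
    "card (perm_cycles n D) + card (perm_cycles n (D \<circ> g)) = n + 1" "E \<subseteq> orbit (D \<circ> g) e"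
    using exists_genus_zero[OF n D sep e] by blast
  then have eq: "label_free_count n E (D \<circ> g) + card (perm_cycles n D) = n"
    using label_free_count_le(2)[OF n D g(1) e] by simp
  have "theta n D E = label_free_count n E (D \<circ> g)"
    unfolding theta_def
  proof (rule Max_eqI)
    fix c assume "c \<in> (\<lambda>g. label_free_count n E (D \<circ> g)) ` cyclic_perms n"
    then obtain h where "h \<in> cyclic_perms n" "c = label_free_count n E (D \<circ> h)" by blast
    then show "c \<le> label_free_count n E (D \<circ> g)"
      using label_free_count_le(1)[OF n D _ e] eq by fastforce
  qed (use g in auto)
  then show ?thesis using eq by simp
qed

subsection \<open>The cut-and-glue move\<close>

text \<open>Cutting between \<open>a\<close> and \<open>b\<close> leaves two cycles, and
  \<open>x\<close> lies in at most one of them. Joining \<open>x\<close> to whichever of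
  \<open>a\<close>, \<open>b\<close> lies in the other restores a single cycle.\<close>

lemma cyclic_perms_three_cycle:
  assumes n: "n \<ge> 1" and g: "g \<in> cyclic_perms n"
    and ab: "a \<in> {1..n}" "b \<in> {1..n}" "a \<noteq> b" and x: "x \<in> {1..n}"
  shows "transpose b x \<circ> (transpose a b \<circ> g) \<in> cyclic_perms n \<or>
    transpose a x \<circ> (transpose b a \<circ> g) \<in> cyclic_perms n"
proof -
  have gp: "g permutes {1..n}" and g1: "card (perm_cycles n g) = 1" and gc: "cyclic_on g {1..n}"
    using g cyclic_perms_iff_card[OF n] by (auto simp: cyclic_perms_def)
  have bo: "b \<in> orbit g a" using gc ab by (auto simp: cyclic_on_alldef)
  let ?h = "transpose a b \<circ> g"
  have hp: "?h permutes {1..n}" using gp ab by (intro transpose_comp_permutes)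
  have Ph: "permutation ?h" using hp by (rule permutes_imp_permutation_atLeastAtMost)
  have ch: "card (perm_cycles n ?h) = 2"
    using card_perm_cycles_split[OF gp ab(1,2) bo ab(3)] g1 by simp
  have joined: "transpose c x \<circ> ?h \<in> cyclic_perms n"
    if "c \<in> {1..n}" "x \<notin> orbit ?h c" for c
    using card_perm_cycles_merge[OF hp that(1) x that(2)] ch
      transpose_comp_permutes[OF hp that(1) x] cyclic_perms_iff_card[OF n] by simp
  have "x \<notin> orbit ?h a \<or> x \<notin> orbit ?h b"
    using transpose_comp_separates[OF permutes_imp_permutation_atLeastAtMost[OF gp] bo ab(3)]
      orbit_eq_iff[OF Ph] by metis
  then show ?thesis using joined ab by (auto simp: transpose_commute)
qed

text \<open>Both pieces cut from the cycle of \<open>E\<close> still contain a label, so the cut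
  creates no counted cycle; the glueing absorbs the label free cycle of \<open>y\<close>. One split
  and one merge preserve the total.\<close>

lemma label_free_count_split_merge:
  assumes s: "s permutes {1..n}" and ab: "a \<in> E" "b \<in> E" "a \<noteq> b" and E: "E \<subseteq> {1..n}"
    and Es: "E \<subseteq> orbit s a" and y: "y \<in> {1..n}" "y \<notin> orbit s a"
    and t_def: "t = transpose b y \<circ> (transpose a b \<circ> s)"
  shows "label_free_count n E t + 1 = label_free_count n E s"
    and "card (perm_cycles n t) = card (perm_cycles n s)"
    and "y \<in> orbit t b"
proof -
  let ?h = "transpose a b \<circ> s"
  have abn: "a \<in> {1..n}" "b \<in> {1..n}" using ab E by auto
  have hp: "?h permutes {1..n}" using s abn by (intro transpose_comp_permutes)
  have tp: "t permutes {1..n}" unfolding t_def using hp abn(2) y(1) by (rule transpose_comp_permutes)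
  have Ps: "permutation s" and Ph: "permutation ?h" and Pt: "permutation t"
    using s hp tp permutes_imp_permutation_atLeastAtMost by blast+
  have bo: "b \<in> orbit s a" using Es ab by blast
  note split = orbit_transpose_comp_split[OF Ps bo ab(3)]
  have yb: "y \<notin> orbit ?h b" using split y by blast
  note merge = orbit_transpose_comp_merge[OF Ph yb, folded t_def]
  show yt: "y \<in> orbit t b"
    using merge permutation_self_in_orbit[OF Ph, of y] by blast
  show "card (perm_cycles n t) = card (perm_cycles n s)"
    using card_perm_cycles_split[OF s abn bo ab(3)] card_perm_cycles_merge[OF hp abn(2) y(1) yb]
    by (simp add: t_def)
  \<comment> \<open>Since \<open>a\<close> and \<open>b\<close> share an \<open>s\<close>-cycle, a
    cycle avoiding \<open>a\<close> and \<open>y\<close> avoids \<open>b\<close> too, and neither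
    transposition touches it.\<close>
  have same: "orbit t z = orbit s z" if "a \<notin> orbit s z" "y \<notin> orbit s z" for z
  proof -
    have "b \<notin> orbit s z"
      using that(1) bo orbit_eq_iff[OF Ps] permutation_self_in_orbit[OF Ps] by metis
    moreover from this have hz: "orbit ?h z = orbit s z"
      using that by (intro orbit_transpose_comp_other[OF Ps])
    ultimately show ?thesis unfolding t_def hz[symmetric]
      using that by (intro orbit_transpose_comp_other[OF Ph]) (auto simp: hz)
  qed
  let ?F = "\<lambda>p. {C \<in> perm_cycles n p. C \<inter> E = {}}"
  have disj: "orbit s y \<inter> E = {}"
  proof (rule ccontr)
    assume "orbit s y \<inter> E \<noteq> {}"
    then obtain u where "u \<in> orbit s y" "u \<in> orbit s a" using Es by blast
    then have "orbit s y = orbit s a" using orbit_eq_iff[OF Ps] by metis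
    then show False using y permutation_self_in_orbit[OF Ps] by blast
  qed
  have in_s: "orbit s y \<in> ?F s" using disj y by (auto simp: perm_cycles_def)
  have "?F t = ?F s - {orbit s y}"
  proof
    show "?F s - {orbit s y} \<subseteq> ?F t"
    proof
      fix C assume C: "C \<in> ?F s - {orbit s y}"
      then obtain z where z: "z \<in> {1..n}" "C = orbit s z" unfolding perm_cycles_def by blast
      have "a \<notin> orbit s z" using C z ab by blast
      moreover have "y \<notin> orbit s z" using C z orbit_eq_iff[OF Ps] by blast
      ultimately have "C = orbit t z" using same z by simp
      then show "C \<in> ?F t" using C z by (auto simp: perm_cycles_def)
    qed
    show "?F t \<subseteq> ?F s - {orbit s y}"
    proof
      fix C assume C: "C \<in> ?F t"
      then obtain z where z: "z \<in> {1..n}" "C = orbit t z" unfolding perm_cycles_def by blast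
      have free: "u \<notin> orbit t z" if "u \<in> E" for u using that C z by blast
      \<comment> \<open>Every point of the \<open>s\<close>-cycles of \<open>a\<close> and
        \<open>y\<close> ends up in the \<open>t\<close>-cycle of \<open>a\<close> or
        \<open>b\<close>, where it meets a label; a label free \<open>t\<close>-cycle therefore
        comes from elsewhere.\<close>
      have nz: "u \<notin> orbit s z" if u: "u = a \<or> u = y" for u
      proof
        assume "u \<in> orbit s z"
        then have "orbit s z = orbit s u" using orbit_eq_iff[OF Ps] by metis
        then have zu: "z \<in> orbit s u" using permutation_self_in_orbit[OF Ps, of z] by simp
        have hy: "orbit ?h y = orbit s y"
          using disj ab by (intro orbit_transpose_comp_other[OF Ps]) auto
        have "z \<in> orbit ?h a \<or> z \<in> orbit t b"
          using u zu split merge hy by blast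
        then show False
        proof
          assume za: "z \<in> orbit ?h a"
          show False
          proof (cases "z \<in> orbit t b")
            case True
            then show ?thesis using free[OF ab(2)] orbit_sym[OF Pt] by blast
          next
            case False
            then have n1: "b \<notin> orbit ?h z" "y \<notin> orbit ?h z"
              using merge orbit_sym[OF Ph] by blast+
            then have "orbit t z = orbit ?h z"
              unfolding t_def by (intro orbit_transpose_comp_other[OF Ph])
            then show ?thesis using za free[OF ab(1)] orbit_sym[OF Ph] by blast
          qed
        next
          assume "z \<in> orbit t b"
          then show False using free[OF ab(2)] orbit_sym[OF Pt] by blast
        qed
      qed
      then have "C = orbit s z" using same[of z] z by simp
      moreover have "orbit s z \<noteq> orbit s y"
        using nz permutation_self_in_orbit[OF Ps, of y] by blast
      ultimately show "C \<in> ?F s - {orbit s y}" using C z by (auto simp: perm_cycles_def)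
    qed
  qed
  moreover have "card (?F s) > 0" using in_s by (auto simp: card_gt_0_iff)
  ultimately show "label_free_count n E t + 1 = label_free_count n E s"
    using in_s by (simp add: label_free_count_def card_Diff_singleton)
qed

text \<open>The preimages under \<open>D\<close> are chosen so that composing with \<open>D\<close>
  turns the move into left multiplication of \<open>D \<circ> g\<close> by
  \<open>transpose b y \<circ> transpose a b\<close>.\<close>

definition three_cycle_move ::
    "(nat \<Rightarrow> nat) \<Rightarrow> nat \<Rightarrow> nat \<Rightarrow> nat \<Rightarrow> (nat \<Rightarrow> nat) \<Rightarrow> nat \<Rightarrow> nat" where
  "three_cycle_move D a b y g =
    transpose (inv D b) (inv D y) \<circ> (transpose (inv D a) (inv D b) \<circ> g)"

lemma comp_three_cycle_move:
  assumes "D permutes S"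
  shows "D \<circ> three_cycle_move D a b y g = transpose b y \<circ> (transpose a b \<circ> (D \<circ> g))"
proof -
  have inj: "inj D" and DD: "D (inv D u) = u" for u
    using permutes_inj[OF assms] permutes_surj[OF assms] by (auto simp: surj_f_inv_f)
  have "D \<circ> three_cycle_move D a b y g =
      (D \<circ> transpose (inv D b) (inv D y)) \<circ> transpose (inv D a) (inv D b) \<circ> g"
    by (simp add: three_cycle_move_def comp_assoc)
  also have "\<dots> = transpose b y \<circ> (D \<circ> transpose (inv D a) (inv D b)) \<circ> g"
    by (simp add: comp_transpose_inj[OF inj] DD comp_assoc)
  also have "\<dots> = transpose b y \<circ> (transpose a b \<circ> (D \<circ> g))"
    by (simp add: comp_transpose_inj[OF inj] DD comp_assoc)
  finally show ?thesis .
qed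

lemma card_move_le:
  assumes n: "n \<ge> 1" and D: "D permutes {1..n}" and E: "E \<subseteq> {1..n}"
    and ab: "a \<in> E" "b \<in> E" "a \<noteq> b" and z: "z \<in> {1..n}"
  shows "card {g \<in> cyclic_perms n. label_free_count n E (D \<circ> g) + card (perm_cycles n D) = n \<and>
      (\<exists>y \<in> orbit D z. y \<notin> orbit (D \<circ> g) a \<and> three_cycle_move D a b y g \<in> cyclic_perms n)}
    \<le> card {g \<in> cyclic_perms n. label_free_count n E (D \<circ> g) + 1 + card (perm_cycles n D) = n}"
    (is "card ?A \<le> card ?B")
proof -
  let ?P = "\<lambda>g y. y \<in> orbit D z \<and> y \<notin> orbit (D \<circ> g) a \<and> three_cycle_move D a b y g \<in> cyclic_perms n"
  \<comment> \<open>Any suitable \<open>y\<close> will do, because the image permutation determines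
    it through \<open>genus_zero_orbits_meet_once\<close>.\<close>
  define Y where "Y g = (SOME y. ?P g y)" for g
  define F where "F g = three_cycle_move D a b (Y g) g" for g
  have Y: "?P g (Y g)" if "g \<in> ?A" for g
    unfolding Y_def by (rule someI_ex) (use that in auto)
  have F: "F g \<in> cyclic_perms n" "label_free_count n E (D \<circ> F g) + 1 + card (perm_cycles n D) = n"
    "card (perm_cycles n D) + card (perm_cycles n (D \<circ> F g)) = n + 1"
    "Y g \<in> orbit (D \<circ> F g) b" "Y g \<in> {1..n}" "Y g \<in> orbit D z" if g: "g \<in> ?A" for g
  proof -
    have gc: "g \<in> cyclic_perms n"
      and gl: "label_free_count n E (D \<circ> g) + card (perm_cycles n D) = n" using g by auto
    have gz: "card (perm_cycles n D) + card (perm_cycles n (D \<circ> g)) = n + 1" "E \<subseteq> orbit (D \<circ> g) a"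
      using label_free_count_le(2)[OF n D gc ab(1) E] gl by auto
    have s: "D \<circ> g permutes {1..n}"
      using D gc by (auto simp: cyclic_perms_def intro: permutes_compose)
    show Yz: "Y g \<in> orbit D z" and "F g \<in> cyclic_perms n" using Y[OF g] by (auto simp: F_def)
    show Yn: "Y g \<in> {1..n}" using Yz permutes_orbit_subset[OF D z] by blast
    have "D \<circ> F g = transpose b (Y g) \<circ> (transpose a b \<circ> (D \<circ> g))"
      unfolding F_def by (rule comp_three_cycle_move[OF D])
    note * = label_free_count_split_merge[OF s ab E gz(2) Yn _ this]
    show "label_free_count n E (D \<circ> F g) + 1 + card (perm_cycles n D) = n"
      "card (perm_cycles n D) + card (perm_cycles n (D \<circ> F g)) = n + 1"
      "Y g \<in> orbit (D \<circ> F g) b"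
      using * Y[OF g] gl gz(1) by auto
  qed
  have "inj_on F ?A"
  proof (rule inj_onI)
    fix g h assume g: "g \<in> ?A" and h: "h \<in> ?A" and eq: "F g = F h"
    have PD: "permutation D" using D by (rule permutes_imp_permutation_atLeastAtMost)
    have "D \<circ> F g permutes {1..n}"
      using D F(1)[OF g] by (auto simp: cyclic_perms_def intro: permutes_compose)
    then have PF: "permutation (D \<circ> F g)" by (rule permutes_imp_permutation_atLeastAtMost)
    have "Y h \<in> orbit D (Y g)" using F(6)[OF g] F(6)[OF h] orbit_eq_iff[OF PD] by metis
    moreover have "Y h \<in> orbit (D \<circ> F g) (Y g)"
      using F(4)[OF g] F(4)[OF h] orbit_eq_iff[OF PF] eq by metis
    ultimately have "Y g = Y h"
      by (rule genus_zero_orbits_meet_once[OF n D F(1)[OF g] F(3)[OF g] F(5)[OF g]])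
    \<comment> \<open>With equal points, both moves multiply by the same permutation, which
      cancels.\<close>
    then show "g = h" using eq by (simp add: F_def three_cycle_move_def transpose_comp_left_cancel)
  qed
  moreover have "F ` ?A \<subseteq> ?B" using F(1,2) by blast
  ultimately show ?thesis by (intro card_inj_on_le[of F]) auto
qed

lemma card_maximizers_le:
  assumes n: "n \<ge> 1" and D: "D permutes {1..n}" "D \<noteq> id"
    and E: "E \<subseteq> {1..n}" "card E > 1"
  shows "card {g \<in> cyclic_perms n. label_free_count n E (D \<circ> g) + card (perm_cycles n D) = n}
    \<le> 2 * card {g \<in> cyclic_perms n. label_free_count n E (D \<circ> g) + 1 + card (perm_cycles n D) = n}"
    (is "card ?A \<le> 2 * card ?B")
proof -
  obtain a b where ab: "a \<in> E" "b \<in> E" "a \<noteq> b"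
    using E(2) by (metis One_nat_def card_le_Suc0_iff_eq card.infinite not_less less_nat_zero_code)
  obtain z where z: "z \<in> {1..n}" "D z \<in> {1..n}" "D z \<noteq> z"
    using permutes_neq_id_moves[OF D] by blast
  let ?Q = "\<lambda>a b. {g \<in> cyclic_perms n. label_free_count n E (D \<circ> g) + card (perm_cycles n D) = n \<and>
      (\<exists>y \<in> orbit D z. y \<notin> orbit (D \<circ> g) a \<and> three_cycle_move D a b y g \<in> cyclic_perms n)}"
  have "?A \<subseteq> ?Q a b \<union> ?Q b a"
  proof
    fix g assume g: "g \<in> ?A"
    then have gc: "g \<in> cyclic_perms n" by simp
    have gz: "card (perm_cycles n D) + card (perm_cycles n (D \<circ> g)) = n + 1" "E \<subseteq> orbit (D \<circ> g) a"
      using label_free_count_le(2)[OF n D(1) gc ab(1) E(1)] g by auto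
    have s: "D \<circ> g permutes {1..n}"
      using D gc by (auto simp: cyclic_perms_def intro: permutes_compose)
    then have Ps: "permutation (D \<circ> g)" by (rule permutes_imp_permutation_atLeastAtMost)
    have oab: "orbit (D \<circ> g) b = orbit (D \<circ> g) a"
      using gz(2) ab orbit_eq_iff[OF Ps] by blast
    have PD: "permutation D" using D(1) by (rule permutes_imp_permutation_atLeastAtMost)
    \<comment> \<open>If \<open>z\<close> lies in the cycle of the labels, \<open>D z\<close>
      cannot, since a \<open>D\<close>-cycle and a cycle of \<open>D \<circ> g\<close> share at most
      one point.\<close>
    obtain y where y: "y \<in> orbit D z" "y \<notin> orbit (D \<circ> g) a" "y \<in> {1..n}"
    proof (cases "z \<in> orbit (D \<circ> g) a")
      case True
      have "D z \<notin> orbit (D \<circ> g) z"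
        using genus_zero_orbits_meet_once[OF n D(1) gc gz(1) z(1) orbit.base] z(3) by metis
      then show ?thesis using that[of "D z"] z True orbit_eq_iff[OF Ps] orbit.base by metis
    next
      case False
      then show ?thesis using that[of z] z permutation_self_in_orbit[OF PD] by blast
    qed
    have invn: "inv D u \<in> {1..n}" if "u \<in> {1..n}" for u
      using that permutes_in_image[OF permutes_inv[OF D(1)]] by blast
    \<comment> \<open>Cyclicity concerns \<open>g\<close> itself, so the cut and glue argument is
      applied to preimages under \<open>D\<close>.\<close>
    have "inv D a \<noteq> inv D b"
      using ab(3) inj_eq[OF permutes_inj[OF permutes_inv[OF D(1)]]] by simp
    then have "three_cycle_move D a b y g \<in> cyclic_perms n \<or> three_cycle_move D b a y g \<in> cyclic_perms n"
      unfolding three_cycle_move_def using n gc ab E y invn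
      by (intro cyclic_perms_three_cycle) auto
    then show "g \<in> ?Q a b \<union> ?Q b a" using g y oab by auto
  qed
  then have "card ?A \<le> card (?Q a b \<union> ?Q b a)" by (intro card_mono) auto
  also have "\<dots> \<le> card (?Q a b) + card (?Q b a)" by (rule card_Un_le)
  also have "\<dots> \<le> card ?B + card ?B"
    using card_move_le[OF n D(1) E(1) ab z(1)]
      card_move_le[OF n D(1) E(1) ab(2,1) ab(3)[symmetric] z(1)] by (rule add_mono)
  finally show ?thesis by simp
qed

section \<open>Reduction to a permutation separating the elements of \<open>E\<close>\<close>

text \<open>Along a label free cycle no value lies in \<open>E\<close>, so \<open>\<pi>\<close>
  alters nothing there; \<open>inv \<pi>\<close> gives the converse inclusion.\<close>

lemma label_free_count_comp_permutes:
  assumes \<pi>: "\<pi> permutes E" and s: "s permutes {1..n}" and E: "E \<subseteq> {1..n}"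
  shows "label_free_count n E (\<pi> \<circ> s) = label_free_count n E s"
proof -
  let ?F = "\<lambda>p. {C \<in> perm_cycles n p. C \<inter> E = {}}"
  have sub: "?F p \<subseteq> ?F (\<rho> \<circ> p)" if p: "p permutes {1..n}" and \<rho>: "\<rho> permutes E" for p \<rho>
  proof
    fix C assume C: "C \<in> ?F p"
    then obtain z where z: "z \<in> {1..n}" "C = orbit p z" by (auto simp: perm_cycles_def)
    have "orbit (\<rho> \<circ> p) z = orbit p z"
    proof (rule orbit_cong)
      show "z \<in> orbit p z"
        using permutation_self_in_orbit[OF permutes_imp_permutation_atLeastAtMost[OF p]] .
      fix u assume "u \<in> orbit p z"
      then have "p u \<in> C" using z by (auto intro: orbit.step)
      then have "p u \<notin> E" using C by blast
      then show "(\<rho> \<circ> p) u = p u" using permutes_not_in[OF \<rho>] by simp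
    qed
    then show "C \<in> ?F (\<rho> \<circ> p)" using C z by (auto simp: perm_cycles_def)
  qed
  have p': "\<pi> \<circ> s permutes {1..n}" using permutes_subset[OF \<pi> E] s by (intro permutes_compose)
  have "?F (\<pi> \<circ> s) \<subseteq> ?F (inv \<pi> \<circ> (\<pi> \<circ> s))" using p' permutes_inv[OF \<pi>] by (rule sub)
  then have "?F (\<pi> \<circ> s) = ?F s"
    using sub[OF s \<pi>] by (simp add: comp_assoc[symmetric] permutes_inv_o[OF \<pi>])
  then show ?thesis by (simp add: label_free_count_def)
qed

text \<open>In a representative with the most cycles, two elements of \<open>E\<close> in one cycle
  could be split by a transposition without leaving the coset.\<close>

lemma exists_separating_representative:
  fixes n :: nat
  assumes D: "D permutes {1..n}" and E: "E \<subseteq> {1..n}"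
  obtains \<pi> where "\<pi> permutes E"
    "\<And>a b. a \<in> E \<Longrightarrow> b \<in> E \<Longrightarrow> b \<in> orbit (\<pi> \<circ> D) a \<Longrightarrow> a = b"
proof -
  let ?m = "\<lambda>\<pi>. card (perm_cycles n (\<pi> \<circ> D))"
  have "\<exists>\<pi>. \<pi> permutes E \<and> (\<forall>\<rho>. \<rho> permutes E \<longrightarrow> ?m \<rho> \<le> ?m \<pi>)"
    \<comment> \<open>Cycle counts are at most \<open>n\<close>; the rule asks for a strict bound,
      hence \<open>Suc n\<close>.\<close>
    by (rule ex_has_greatest_nat[where k = id and b = "Suc n"])
      (auto simp: permutes_id card_perm_cycles_le le_imp_less_Suc)
  then obtain \<pi> where \<pi>: "\<pi> permutes E" and max: "\<And>\<rho>. \<rho> permutes E \<Longrightarrow> ?m \<rho> \<le> ?m \<pi>" by blast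
  have p: "\<pi> \<circ> D permutes {1..n}" using permutes_subset[OF \<pi> E] D by (intro permutes_compose)
  have "a = b" if ab: "a \<in> E" "b \<in> E" "b \<in> orbit (\<pi> \<circ> D) a" for a b
  proof (rule ccontr)
    assume "a \<noteq> b"
    then have "card (perm_cycles n (transpose a b \<circ> (\<pi> \<circ> D))) = ?m \<pi> + 1"
      using ab E by (intro card_perm_cycles_split[OF p]) auto
    then show False
      using max[OF transpose_comp_permutes[OF \<pi> ab(1,2)]] by (simp add: comp_assoc)
  qed
  then show thesis using that \<pi> by blast
qed

text \<open>Turns the cycle hypothesis into the fact that the identity is not in the coset of
  \<open>D\<close>: otherwise each cycle would lie inside \<open>E\<close> or be a fixed point
  outside it.\<close>

lemma admissible_not_permutes:
  assumes "admissible n D E"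
  shows "\<not> D permutes E"
proof
  assume DE: "D permutes E"
  have 1: "orbit D z = {z}" if "z \<notin> E" for z
    using permutes_not_in[OF DE that] by (simp add: orbit_eq_singleton_iff)
  have 2: "orbit D z \<subseteq> E" if "z \<in> E" for z using permutes_orbit_subset[OF DE that] .
  have D: "permutation D"
    using assms permutes_imp_permutation_atLeastAtMost by (auto simp: admissible_def)
  note self = permutation_self_in_orbit[OF D]
  have "\<not> (card C > 1 \<and> C \<inter> E = {})" "\<not> (C \<inter> E \<noteq> {} \<and> C \<inter> ({1..n} - E) \<noteq> {})"
    if C: "C \<in> perm_cycles n D" for C
  proof -
    obtain z where z: "C = orbit D z" using C by (auto simp: perm_cycles_def)
    show "\<not> (card C > 1 \<and> C \<inter> E = {})" using 1[of z] self[of z] z by (cases "z \<in> E") auto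
    show "\<not> (C \<inter> E \<noteq> {} \<and> C \<inter> ({1..n} - E) \<noteq> {})" using 1[of z] 2[of z] z by (cases "z \<in> E") auto
  qed
  then show False using assms unfolding admissible_def by blast
qed

lemma card_theta_le:
  assumes "admissible n D E"
  shows "card {g \<in> cyclic_perms n. label_free_count n E (D \<circ> g) = theta n D E}
    \<le> 2 * card {g \<in> cyclic_perms n. int (label_free_count n E (D \<circ> g)) = int (theta n D E) - 1}"
proof -
  have n: "n \<ge> 1" and D: "D permutes {1..n}" and E: "E \<subseteq> {1..n}" "card E > 1"
    using assms by (auto simp: admissible_def)
  obtain e where e: "e \<in> E" using E(2) by fastforce
  obtain \<pi> where \<pi>: "\<pi> permutes E"
    and sep: "\<And>a b. a \<in> E \<Longrightarrow> b \<in> E \<Longrightarrow> b \<in> orbit (\<pi> \<circ> D) a \<Longrightarrow> a = b"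
    using exists_separating_representative[OF D E(1)] by blast
  define D' where "D' = \<pi> \<circ> D"
  have D': "D' permutes {1..n}"
    unfolding D'_def using permutes_subset[OF \<pi> E(1)] D by (intro permutes_compose)
  have ne: "D' \<noteq> id"
  proof
    assume "D' = id"
    then have "inv \<pi> \<circ> (\<pi> \<circ> D) = inv \<pi>" by (simp add: D'_def)
    then have "D = inv \<pi>" by (simp add: comp_assoc[symmetric] permutes_inv_o[OF \<pi>])
    then show False using permutes_inv[OF \<pi>] admissible_not_permutes[OF assms] by simp
  qed
  have eq: "label_free_count n E (D' \<circ> g) = label_free_count n E (D \<circ> g)" if "g \<in> cyclic_perms n" for g
  proof -
    have "D \<circ> g permutes {1..n}"
      using D that by (auto simp: cyclic_perms_def intro: permutes_compose)
    from label_free_count_comp_permutes[OF \<pi> this E(1)] show ?thesis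
      by (simp add: D'_def comp_assoc)
  qed
  have "theta n D' E = theta n D E"
    unfolding theta_def using eq by (simp cong: image_cong)
  then have th: "theta n D E + card (perm_cycles n D') = n"
    using theta_eq[OF n D' sep[folded D'_def] e E(1)] by simp
  have "{g \<in> cyclic_perms n. label_free_count n E (D \<circ> g) = theta n D E}
      = {g \<in> cyclic_perms n. label_free_count n E (D' \<circ> g) + card (perm_cycles n D') = n}"
    using eq th by auto
  \<comment> \<open>The subtraction is over the integers, so for \<open>theta n D E = 0\<close> both
    sets are empty; \<open>th\<close> gives the additive form.\<close>
  moreover have "{g \<in> cyclic_perms n. int (label_free_count n E (D \<circ> g)) = int (theta n D E) - 1}
      = {g \<in> cyclic_perms n. label_free_count n E (D' \<circ> g) + 1 + card (perm_cycles n D') = n}"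
    using eq th by auto
  ultimately show ?thesis using card_maximizers_le[OF n D' ne E] by simp
qed

subsection \<open>The case of equality\<close>

text \<open>For distinct \<open>a\<close>, \<open>b\<close>, \<open>c\<close> other than 1 this is
  the cycle \<open>(1 a b c)\<close>; starting at 1 makes the triple unique.\<close>

definition four_cycle :: "nat \<Rightarrow> nat \<Rightarrow> nat \<Rightarrow> nat \<Rightarrow> nat" where
  "four_cycle a b c = transpose 1 a \<circ> (transpose a b \<circ> transpose b c)"

lemma cyclic_perms_4_imp_four_cycle:
  assumes g: "g \<in> cyclic_perms 4"
  obtains a b c where "{a, b, c} = {2, 3, 4}" "distinct [a, b, c]" "g = four_cycle a b c"
proof -
  have gp: "g permutes {1..4}" and gc: "cyclic_on g {1..4}" using g by (auto simp: cyclic_perms_def)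
  have S: "{1..4} = {1, 2, 3, 4::nat}" by auto
  \<comment> \<open>By cyclicity no proper subset of the four points contains 1 and is closed under
    \<open>g\<close>; this rules out an early return to 1.\<close>
  have closed: "{1, 2, 3, 4} \<subseteq> A" if "1 \<in> A" "\<And>u. u \<in> A \<Longrightarrow> g u \<in> A" for A
  proof -
    have "orbit g 1 = {1..4}" using gc by (auto simp: cyclic_on_alldef)
    then show ?thesis using orbit_subset_closed[of 1 A g] that unfolding S by simp
  qed
  define a b c where "a = g 1" and "b = g a" and "c = g b"
  then have gv: "g 1 = a" "g a = b" "g b = c" by simp_all
  have inj: "g u = g v \<longleftrightarrow> u = v" for u v using inj_eq[OF permutes_inj[OF gp]] .
  have in4: "g u \<in> {1, 2, 3, 4}" if "u \<in> {1, 2, 3, 4}" for u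
    using that permutes_in_image[OF gp, of u] unfolding S by blast
  have m: "a \<in> {1, 2, 3, 4}" "b \<in> {1, 2, 3, 4}" "c \<in> {1, 2, 3, 4}" "g c \<in> {1, 2, 3, 4}"
    unfolding a_def b_def c_def using in4 by auto
  have a1: "a \<noteq> 1" using closed[of "{1}"] a_def by auto
  have b1: "b \<noteq> 1"
  proof
    assume "b = 1"
    then have "{1, 2, 3, 4} \<subseteq> {1, a}" by (intro closed) (use gv in auto)
    then show False by auto
  qed
  have c1: "c \<noteq> 1"
  proof
    assume "c = 1"
    then have "{1, 2, 3, 4} \<subseteq> {1, a, b}"
      by (intro closed) (use gv in auto)
    then show False by auto
  qed
  have d: "distinct [a, b, c]" using a1 b1 inj a_def b_def c_def by auto
  have abc: "{a, b, c} = {2, 3, 4}" using a1 b1 c1 d m by auto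
  have gc1: "g c = 1"
  proof -
    have "g c \<noteq> a" "g c \<noteq> b" "g c \<noteq> c" using c1 d inj a_def b_def c_def by auto
    then have "g c \<notin> {2, 3, 4}" unfolding abc[symmetric] by simp
    then show ?thesis using m(4) by blast
  qed
  have "g u = four_cycle a b c u" for u
  proof (cases "u \<in> {1, 2, 3, 4}")
    case True
    then have "u = 1 \<or> u \<in> {a, b, c}" unfolding abc by blast
    then show ?thesis
      using a1 b1 c1 d gc1 a_def b_def c_def by (auto simp: four_cycle_def transpose_def)
  next
    case False
    then have "g u = u" using permutes_not_in[OF gp] unfolding S by blast
    moreover have "u \<noteq> 1" "u \<noteq> a" "u \<noteq> b" "u \<noteq> c" using False m by auto
    ultimately show ?thesis by (simp add: four_cycle_def)
  qed
  then show thesis using that[OF abc d] by blast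
qed

lemma four_cycle_in_cyclic_perms:
  assumes abc: "{a, b, c} = {2, 3, 4}" "distinct [a, b, c]"
  shows "four_cycle a b c \<in> cyclic_perms 4"
proof -
  have m: "a \<in> {2, 3, 4}" "b \<in> {2, 3, 4}" "c \<in> {2, 3, 4}" using abc by auto
  then have ne: "a \<noteq> 1" "b \<noteq> 1" "c \<noteq> 1" by auto
  let ?g = "four_cycle a b c"
  have p: "?g permutes {1..4}"
    unfolding four_cycle_def using m
    by (intro transpose_comp_permutes permutes_swap_id) auto
  have v: "?g 1 = a" "?g a = b" "?g b = c" "?g c = 1"
    using ne abc(2) by (auto simp: four_cycle_def transpose_def)
  have "a \<in> orbit ?g 1" using orbit.base[of ?g 1] v by simp
  moreover from this have "b \<in> orbit ?g 1" using orbit.step[of a ?g 1] v by simp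
  moreover from this have "c \<in> orbit ?g 1" using orbit.step[of b ?g 1] v by simp
  moreover from this have "1 \<in> orbit ?g 1" using orbit.step[of c ?g 1] v by simp
  ultimately have "insert 1 {a, b, c} \<subseteq> orbit ?g 1" by simp
  moreover have "{1..4} = insert 1 {2, 3, 4::nat}" by auto
  ultimately have "{1..4} \<subseteq> orbit ?g 1" using abc by simp
  then have "{1..4} = orbit ?g 1" using permutes_orbit_subset[OF p, of 1] by auto
  then have "cyclic_on ?g {1..4}" by (rule cyclic_on_singleI[rotated]) simp
  then show ?thesis using p by (simp add: cyclic_perms_def)
qed

lemma cyclic_perms_4:
  "cyclic_perms 4 = (\<lambda>(a, b, c). four_cycle a b c) `
    {(2, 3, 4), (2, 4, 3), (3, 2, 4), (3, 4, 2), (4, 2, 3), (4, 3, 2)}" (is "_ = ?F ` ?T")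
proof
  show "cyclic_perms 4 \<subseteq> ?F ` ?T"
  proof
    fix g assume "g \<in> cyclic_perms 4"
    then obtain a b c where abc: "{a, b, c} = {2, 3, 4}" "distinct [a, b, c]" "g = four_cycle a b c"
      by (rule cyclic_perms_4_imp_four_cycle)
    have "a \<in> {2, 3, 4}" "b \<in> {2, 3, 4}" "c \<in> {2, 3, 4}" using abc by auto
    then have "(a, b, c) \<in> ?T" using abc(2) by auto
    then show "g \<in> ?F ` ?T" using abc(3) by force
  qed
  have "four_cycle 2 3 4 \<in> cyclic_perms 4" "four_cycle 2 4 3 \<in> cyclic_perms 4"
    "four_cycle 3 2 4 \<in> cyclic_perms 4" "four_cycle 3 4 2 \<in> cyclic_perms 4"
    "four_cycle 4 2 3 \<in> cyclic_perms 4" "four_cycle 4 3 2 \<in> cyclic_perms 4"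
    by (rule four_cycle_in_cyclic_perms; auto)+
  then show "?F ` ?T \<subseteq> cyclic_perms 4" by simp
qed

lemma inj_on_four_cycle:
  "inj_on (\<lambda>(a, b, c). four_cycle a b c)
    {(2, 3, 4), (2, 4, 3), (3, 2, 4), (3, 4, 2), (4, 2, 3), (4, 3, 2)}" (is "inj_on ?F ?T")
proof (rule inj_onI)
  fix s t assume s: "s \<in> ?T" and t: "t \<in> ?T" and eq: "?F s = ?F t"
  have "?F s 1 = ?F t 1" "?F s 2 = ?F t 2" "?F s 3 = ?F t 3" using eq by simp_all
  then show "s = t" using s t by (auto simp: four_cycle_def transpose_def)
qed

text \<open>A label free cycle lies inside \<open>{3, 4}\<close>. As \<open>g\<close> has no fixed
  point there, it must send one of 3 and 4 to the other; conversely the transposition then creates a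
  fixed point.\<close>

lemma label_free_count_example:
  assumes g: "g \<in> cyclic_perms 4"
  shows "label_free_count 4 {1, 2} (transpose 3 4 \<circ> g) = (if g 3 = 4 \<or> g 4 = 3 then 1 else 0)"
proof -
  let ?D = "transpose 3 4 :: nat \<Rightarrow> nat"
  let ?s = "?D \<circ> g"
  let ?F = "{C \<in> perm_cycles 4 ?s. C \<inter> {1, 2} = {}}"
  have D: "?D permutes {1..4}" by (rule permutes_swap_id) auto
  \<comment> \<open>Three cycles of the transposition on four points give the upper bound
    \<open>4 - 3 = 1\<close>.\<close>
  have cD: "card (perm_cycles 4 ?D) = 3"
    using card_perm_cycles_merge[of id 4 3 4] card_perm_cycles_id[of 4]
    by (simp add: permutes_id orbit_eq_singleton_iff[THEN iffD2])
  have le: "label_free_count 4 {1, 2} ?s \<le> 1"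
    using label_free_count_le(1)[OF _ D g, of 1 "{1, 2}"] cD by simp
  have gp: "g permutes {1..4}" and gc: "cyclic_on g {1..4}" using g by (auto simp: cyclic_perms_def)
  have sp: "?s permutes {1..4}" using D gp by (intro permutes_compose)
  have "label_free_count 4 {1, 2} ?s \<noteq> 0 \<longleftrightarrow> g 3 = 4 \<or> g 4 = 3"
  proof
    assume "label_free_count 4 {1, 2} ?s \<noteq> 0"
    then have "?F \<noteq> {}" unfolding label_free_count_def by (metis card.empty)
    then obtain C where "C \<in> ?F" by blast
    then obtain z where z: "z \<in> {1..4}" "orbit ?s z \<inter> {1, 2} = {}" by (auto simp: perm_cycles_def)
    have sub: "orbit ?s z \<subseteq> {3, 4}"
    proof
      fix u assume u: "u \<in> orbit ?s z"
      then have "u \<in> {1..4}" using permutes_orbit_subset[OF sp z(1)] by blast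
      moreover have "u \<noteq> 1" "u \<noteq> 2" using u z(2) by auto
      ultimately show "u \<in> {3, 4}" by auto
    qed
    have "z \<in> orbit ?s z"
      using permutation_self_in_orbit[OF permutes_imp_permutation_atLeastAtMost[OF sp]] .
    then have z34: "z \<in> {3, 4}" using sub by blast
    have s1: "?s z \<in> {3, 4}" using sub orbit.base[of ?s z] by blast
    have g3: "g 3 \<noteq> 3"
    proof
      assume "g 3 = 3"
      then have "orbit g 3 = {3}" by (simp add: orbit_eq_singleton_iff)
      moreover have "orbit g 3 = {1..4}" using gc by (auto simp: cyclic_on_alldef)
      ultimately have "(1::nat) \<in> {3}" by (metis atLeastAtMost_iff le_numeral_extra(4) one_le_numeral)
      then show False by simp
    qed
    have g4: "g 4 \<noteq> 4"
    proof
      assume "g 4 = 4"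
      then have "orbit g 4 = {4}" by (simp add: orbit_eq_singleton_iff)
      moreover have "orbit g 4 = {1..4}" using gc by (auto simp: cyclic_on_alldef)
      ultimately have "(1::nat) \<in> {4}" by (metis atLeastAtMost_iff le_numeral_extra(4) one_le_numeral)
      then show False by simp
    qed
    show "g 3 = 4 \<or> g 4 = 3" using z34 s1 g3 g4 by (auto simp: transpose_def split: if_splits)
  next
    assume "g 3 = 4 \<or> g 4 = 3"
    then have "?s 3 = 3 \<or> ?s 4 = 4" by auto
    then obtain z where z: "z \<in> {3, 4}" "?s z = z" by blast
    then have "orbit ?s z \<in> perm_cycles 4 ?s" "orbit ?s z = {z}"
      by (auto simp: perm_cycles_def orbit_eq_singleton_iff)
    then have "{z} \<in> ?F" using z by auto
    moreover have "finite ?F" by simp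
    ultimately show "label_free_count 4 {1, 2} ?s \<noteq> 0"
      unfolding label_free_count_def using card_eq_0_iff[of ?F] by blast
  qed
  then show ?thesis using le by auto
qed

text \<open>Here the maximum is 1, attained by those 4-cycles in which 3 and 4 are neighbours: four
  of the six.\<close>

lemma equality_example:
  defines "D \<equiv> transpose 3 4" and "E \<equiv> {1, 2}"
  shows "admissible 4 D E"
    and "card {g \<in> cyclic_perms 4. int (label_free_count 4 E (D \<circ> g)) = int (theta 4 D E) - 1} = 2"
    and "card {g \<in> cyclic_perms 4. label_free_count 4 E (D \<circ> g) = theta 4 D E} = 4"
proof -
  have "orbit D 3 = {3, 4}"
  proof
    show "orbit D 3 \<subseteq> {3, 4}" by (rule orbit_subset_closed) (auto simp: D_def)
    have "4 \<in> orbit D 3" using orbit.base[of D 3] by (simp add: D_def)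
    moreover from this have "3 \<in> orbit D 3" using orbit.step[of 4 D 3] by (simp add: D_def)
    ultimately show "{3, 4} \<subseteq> orbit D 3" by simp
  qed
  then have "{3, 4} \<in> perm_cycles 4 D" unfolding perm_cycles_def by (intro image_eqI[of _ _ 3]) auto
  moreover have "card {3, 4::nat} > 1" "{3, 4} \<inter> E = {}" by (auto simp: E_def)
  moreover have "D permutes {1..4}" unfolding D_def by (rule permutes_swap_id) auto
  moreover have "(4::nat) \<ge> 1" "E \<subseteq> {1..4}" "card E > 1" by (auto simp: E_def)
  ultimately show "admissible 4 D E" unfolding admissible_def by blast
  let ?F = "\<lambda>(a, b, c). four_cycle a b c"
  let ?T = "{(2, 3, 4), (2, 4, 3), (3, 2, 4), (3, 4, 2), (4, 2, 3), (4, 3, 2)} :: (nat \<times> nat \<times> nat) set"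
  let ?P = "\<lambda>g. g 3 = (4::nat) \<or> g 4 = (3::nat)"
  have count: "label_free_count 4 E (D \<circ> g) = (if ?P g then 1 else 0)" if "g \<in> cyclic_perms 4" for g
    using label_free_count_example[OF that] by (simp add: D_def E_def)
  have mem: "four_cycle 2 3 4 \<in> cyclic_perms 4" by (rule four_cycle_in_cyclic_perms) auto
  have P: "?P (four_cycle 2 3 4)" "?P (four_cycle 2 4 3)" "?P (four_cycle 3 4 2)"
    "?P (four_cycle 4 3 2)" "\<not> ?P (four_cycle 3 2 4)" "\<not> ?P (four_cycle 4 2 3)"
    by (simp_all add: four_cycle_def transpose_def)
  have th: "theta 4 D E = 1"
    unfolding theta_def
  proof (rule Max_eqI)
    have "label_free_count 4 E (D \<circ> four_cycle 2 3 4) = 1" using count[OF mem] P(1) by simp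
    then show "1 \<in> (\<lambda>g. label_free_count 4 E (D \<circ> g)) ` cyclic_perms 4"
      using mem by (metis image_eqI)
    fix c assume "c \<in> (\<lambda>g. label_free_count 4 E (D \<circ> g)) ` cyclic_perms 4"
    then obtain g where "g \<in> cyclic_perms 4" "c = label_free_count 4 E (D \<circ> g)" by blast
    then show "c \<le> 1" using count[of g] by simp
  qed simp
  have "label_free_count 4 E (D \<circ> g) = theta 4 D E \<longleftrightarrow> ?P g"
    "int (label_free_count 4 E (D \<circ> g)) = int (theta 4 D E) - 1 \<longleftrightarrow> \<not> ?P g"
    if "g \<in> cyclic_perms 4" for g
    unfolding th count[OF that] by simp_all
  then have "{g \<in> cyclic_perms 4. label_free_count 4 E (D \<circ> g) = theta 4 D E}
      = {g \<in> cyclic_perms 4. ?P g}"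
    and "{g \<in> cyclic_perms 4. int (label_free_count 4 E (D \<circ> g)) = int (theta 4 D E) - 1}
      = {g \<in> cyclic_perms 4. \<not> ?P g}"
    by blast+
  \<comment> \<open>Counting moves to the six triples, on which \<open>four_cycle\<close> is
    injective.\<close>
  then have "{g \<in> cyclic_perms 4. label_free_count 4 E (D \<circ> g) = theta 4 D E}
      = ?F ` {t \<in> ?T. ?P (?F t)}"
    and "{g \<in> cyclic_perms 4. int (label_free_count 4 E (D \<circ> g)) = int (theta 4 D E) - 1}
      = ?F ` {t \<in> ?T. \<not> ?P (?F t)}"
    unfolding cyclic_perms_4 Compr_image_eq .
  moreover have "{t \<in> ?T. ?P (?F t)} = {(2, 3, 4), (2, 4, 3), (3, 4, 2), (4, 3, 2)}"
    and "{t \<in> ?T. \<not> ?P (?F t)} = {(3, 2, 4), (4, 2, 3)}"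
    using P by auto
  moreover have cardF: "card (?F ` X) = card X" if "X \<subseteq> ?T" for X
    using card_image[OF inj_on_subset[OF inj_on_four_cycle that]] .
  have "card (?F ` {(2, 3, 4), (2, 4, 3), (3, 4, 2), (4, 3, 2)}) = 4"
    "card (?F ` {(3, 2, 4), (4, 2, 3)}) = 2"
    by (subst cardF; simp)+
  ultimately show
    "card {g \<in> cyclic_perms 4. int (label_free_count 4 E (D \<circ> g)) = int (theta 4 D E) - 1} = 2"
    "card {g \<in> cyclic_perms 4. label_free_count 4 E (D \<circ> g) = theta 4 D E} = 4"
    by (simp_all only:)
qed

theorem theorem1:
  shows "(\<forall>n D E. admissible n D E \<longrightarrow>
            real (card {g \<in> cyclic_perms n.
                    int (label_free_count n E (D \<circ> g)) = int (theta n D E) - 1})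
            \<ge> 1 / 2 * real (card {g \<in> cyclic_perms n.
                    label_free_count n E (D \<circ> g) = theta n D E})) \<and>
         (\<exists>n D E. admissible n D E \<and>
            real (card {g \<in> cyclic_perms n.
                    int (label_free_count n E (D \<circ> g)) = int (theta n D E) - 1})
            = 1 / 2 * real (card {g \<in> cyclic_perms n.
                    label_free_count n E (D \<circ> g) = theta n D E}))"
proof (intro conjI allI impI)
  fix n D E assume "admissible n D E"
  from card_theta_le[OF this]
  show "real (card {g \<in> cyclic_perms n. int (label_free_count n E (D \<circ> g)) = int (theta n D E) - 1})
      \<ge> 1 / 2 * real (card {g \<in> cyclic_perms n. label_free_count n E (D \<circ> g) = theta n D E})"
    by linarith
next
  show "\<exists>n D E. admissible n D E \<and>
      real (card {g \<in> cyclic_perms n. int (label_free_count n E (D \<circ> g)) = int (theta n D E) - 1})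
      = 1 / 2 * real (card {g \<in> cyclic_perms n. label_free_count n E (D \<circ> g) = theta n D E})"
    using equality_example
    by (intro exI[of _ 4] exI[of _ "transpose 3 4"] exI[of _ "{1, 2}"]) simp
qed

end
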